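(* Let $G$ be a multigraph with maximum edge multiplicity $\mu$ and maximum degree $\Delta$, and suppose $G$ contains no cycle of length $5$ as a subgraph. Let $M$ be a set of edges of $G$ such that the distance between any two distinct edges of $M$ is at least $5$. Suppose each edge of $M$ is assigned a colour from the palette $\mathcal{K}=\{1,\dots,\Delta+\mu\}$, arbitrarily. Then there is a proper edge-colouring of $G$ using only colours from $\mathcal{K}$ that agrees with this precolouring on $M$.
   Context: The distance between two edges is the number of edges in a shortest path between an endpoint of one and an endpoint of the other. A proper edge-colouring assigns colours to edges so that any two edges sharing an endpoint receive different colours (parallel edges share endpoints). Multigraphs may have parallel edges; the maximum edge multiplicity is the largest number of edges joining a single pair of vertices. *)

theory Defs
  imports Main "HOL-Library.Extended_Nat"
begin

text \<open>Edges are abstract objects mapped to their sets of endpoints, so distinct edges may be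
  parallel. As usual for proper edge-colourings, multigraphs are finite and loopless.\<close>

record ('v, 'e) multigraph =
  verts :: "'v set"
  edges :: "'e set"
  ends :: "'e \<Rightarrow> 'v set"

definition wf_multigraph :: "('v, 'e) multigraph \<Rightarrow> bool" where
  "wf_multigraph G \<longleftrightarrow> finite (verts G) \<and> finite (edges G) \<and>
     (\<forall>e\<in>edges G. ends G e \<subseteq> verts G \<and> card (ends G e) = 2)"

definition degree :: "('v, 'e) multigraph \<Rightarrow> 'v \<Rightarrow> nat" where
  "degree G v = card {e \<in> edges G. v \<in> ends G e}"

definition multiplicity :: "('v, 'e) multigraph \<Rightarrow> 'v \<Rightarrow> 'v \<Rightarrow> nat" where
  "multiplicity G u v = card {e \<in> edges G. ends G e = {u, v}}"

text \<open>Inserting 0 only matters for the graph without vertices.\<close>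

definition max_degree :: "('v, 'e) multigraph \<Rightarrow> nat" where
  "max_degree G = Max (insert 0 (degree G ` verts G))"

definition max_multiplicity :: "('v, 'e) multigraph \<Rightarrow> nat" where
  "max_multiplicity G = Max (insert 0 {multiplicity G u v |u v. u \<in> verts G \<and> v \<in> verts G})"

definition is_path :: "('v, 'e) multigraph \<Rightarrow> 'v list \<Rightarrow> 'e list \<Rightarrow> bool" where
  "is_path G vs es \<longleftrightarrow> length vs = Suc (length es) \<and> distinct vs \<and>
     set vs \<subseteq> verts G \<and> set es \<subseteq> edges G \<and>
     (\<forall>i<length es. ends G (es ! i) = {vs ! i, vs ! Suc i})"

text \<open>The infimum is \<open>\<infinity>\<close> when the two edges lie in different components.\<close>

definition edge_dist :: "('v, 'e) multigraph \<Rightarrow> 'e \<Rightarrow> 'e \<Rightarrow> enat" where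
  "edge_dist G e f =
     Inf {enat (length es) |vs es. is_path G vs es \<and> hd vs \<in> ends G e \<and> last vs \<in> ends G f}"

text \<open>Distinctness of \<open>es\<close> only matters for length 2, where a cycle is a pair of parallel edges.\<close>

definition is_cycle :: "('v, 'e) multigraph \<Rightarrow> 'v list \<Rightarrow> 'e list \<Rightarrow> bool" where
  "is_cycle G vs es \<longleftrightarrow> length vs = length es \<and> 2 \<le> length es \<and> distinct vs \<and> distinct es \<and>
     set vs \<subseteq> verts G \<and> set es \<subseteq> edges G \<and>
     (\<forall>i<length es. ends G (es ! i) = {vs ! i, vs ! (Suc i mod length vs)})"

definition has_cycle_of_length :: "('v, 'e) multigraph \<Rightarrow> nat \<Rightarrow> bool" where
  "has_cycle_of_length G n \<longleftrightarrow> (\<exists>vs es. is_cycle G vs es \<and> length es = n)"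

definition proper_edge_colouring :: "('v, 'e) multigraph \<Rightarrow> nat set \<Rightarrow> ('e \<Rightarrow> nat) \<Rightarrow> bool" where
  "proper_edge_colouring G K \<phi> \<longleftrightarrow> (\<forall>e\<in>edges G. \<phi> e \<in> K) \<and>
     (\<forall>e\<in>edges G. \<forall>f\<in>edges G. e \<noteq> f \<and> ends G e \<inter> ends G f \<noteq> {} \<longrightarrow> \<phi> e \<noteq> \<phi> f)"

end

theory Submission
  imports Defs "HOL-Library.Transitive_Closure_Table" "HOL-Combinatorics.Transposition"
begin

text \<open>Reserve one colour \<open>z\<close> of the palette and call \<open>C\<close> the remaining \<open>\<Delta> + \<mu> - 1\<close> colours.
  By the theorem of Berge and Fournier there are a matching \<open>N \<supseteq> M\<close> and a proper colouring
  of \<open>G - N\<close> from \<open>C\<close>; colour \<open>N\<close> with \<open>z\<close>. An edge \<open>e = uv\<close> of \<open>M\<close> with prescribed colour \<open>c\<close>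
  can be repaired locally, by giving \<open>e\<close> the colour \<open>c\<close> and \<open>z\<close> to the \<open>c\<close>-coloured edges \<open>uu'\<close>, \<open>vv'\<close>,
  as soon as \<open>N\<close> covers neither \<open>u'\<close> nor \<open>v'\<close>.

  Choose \<open>N\<close> of minimum size and then the pair of matching and colouring with the largest number of
  ends \<open>u\<close> that have a \<open>c\<close>-coloured edge to an uncovered vertex. If \<open>u'\<close> is covered by an edge
  \<open>u'x\<close> of \<open>N\<close>, then this edge cannot be coloured from \<open>C\<close>, so by Vizing's counting argument its fan
  at \<open>x\<close> contains an uncovered vertex \<open>t\<close>. Shifting the fan replaces \<open>u'x\<close> by \<open>xt\<close> in \<open>N\<close>
  and only recolours edges at \<open>x\<close>. It uncovers \<open>u'\<close>, and the newly covered \<open>t\<close> spoils no other end: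
  \<open>t = v'\<close> would give the 5-cycle \<open>u u' x t v\<close>, and if \<open>t\<close> were adjacent to another edge of \<open>M\<close>,
  that edge would be at distance at most 4 from \<open>e\<close>.\<close>

section \<open>Vizing fans\<close>

text \<open>No assumptions are made, so that the same notions serve both for the reduced palette
  \<open>C\<close> and, in \<open>extension\<close>, for the full palette
  \<open>insert z C\<close>.\<close>

locale edge_palette =
  fixes en :: "'e \<Rightarrow> 'v set" and C :: "'c set"
begin

definition proper :: "'e set \<Rightarrow> ('e \<Rightarrow> 'c) \<Rightarrow> bool" where
  "proper F \<phi> \<longleftrightarrow> (\<forall>e\<in>F. \<phi> e \<in> C) \<and>
     (\<forall>e\<in>F. \<forall>f\<in>F. e \<noteq> f \<and> en e \<inter> en f \<noteq> {} \<longrightarrow> \<phi> e \<noteq> \<phi> f)"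

definition missing :: "'e set \<Rightarrow> ('e \<Rightarrow> 'c) \<Rightarrow> 'v \<Rightarrow> 'c set" where
  "missing F \<phi> v = {c \<in> C. \<forall>e\<in>F. v \<in> en e \<longrightarrow> \<phi> e \<noteq> c}"

text \<open>The choice is meaningful only if \<open>x\<close> is one of exactly two ends of
  \<open>e\<close>; see \<open>far_props\<close>.\<close>

definition far :: "'v \<Rightarrow> 'e \<Rightarrow> 'v" where
  "far x e = (SOME w. en e = {x, w})"

text \<open>Vizing fans are encoded as a relation rather than as sequences: a fan is a path of this
  relation, and the edges reachable from an uncoloured \<open>h\<close> form a maximal fan that can
  be counted as one set. Relating edges instead of fan vertices accommodates parallel edges.\<close>

definition fan_step :: "'e set \<Rightarrow> ('e \<Rightarrow> 'c) \<Rightarrow> 'v \<Rightarrow> 'e \<Rightarrow> 'e \<Rightarrow> bool" where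
  "fan_step F \<phi> x a b \<longleftrightarrow> b \<in> F \<and> x \<in> en b \<and> \<phi> b \<in> missing F \<phi> (far x a)"

lemma properD: "proper F \<phi> \<Longrightarrow> e \<in> F \<Longrightarrow> f \<in> F \<Longrightarrow> v \<in> en e \<Longrightarrow> v \<in> en f \<Longrightarrow> \<phi> e = \<phi> f \<Longrightarrow> e = f"
  unfolding proper_def by blast

lemma properI:
  assumes "\<And>e. e \<in> F \<Longrightarrow> \<phi> e \<in> C"
    and "\<And>e f v. e \<in> F \<Longrightarrow> f \<in> F \<Longrightarrow> v \<in> en e \<Longrightarrow> v \<in> en f \<Longrightarrow> \<phi> e = \<phi> f \<Longrightarrow> e = f"
  shows "proper F \<phi>"
  using assms unfolding proper_def by blast

lemma far_props:
  assumes "card (en e) = 2" "x \<in> en e"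
  shows "en e = {x, far x e}" "far x e \<noteq> x"
proof -
  obtain a b where ab: "en e = {a, b}" "a \<noteq> b" using assms(1) by (meson card_2_iff)
  with assms(2) have "\<exists>w. en e = {x, w}" by auto
  then show 1: "en e = {x, far x e}" unfolding far_def by (rule someI_ex)
  show "far x e \<noteq> x" using 1 assms(1) by auto
qed

lemma proper_insert:
  assumes "proper F \<phi>" "card (en k) = 2" "x \<in> en k" "k \<notin> F"
    and "c \<in> missing F \<phi> x" "c \<in> missing F \<phi> (far x k)"
  shows "proper (insert k F) (\<phi>(k := c))"
proof (rule properI)
  fix e assume "e \<in> insert k F"
  then show "(\<phi>(k := c)) e \<in> C" using assms unfolding proper_def missing_def by auto
next
  fix e f v
  assume *: "e \<in> insert k F" "f \<in> insert k F" "v \<in> en e" "v \<in> en f"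
    "(\<phi>(k := c)) e = (\<phi>(k := c)) f"
  have new: "\<phi> g \<noteq> c" if "g \<in> F" "v \<in> en g" "v \<in> en k" for g
    using that assms far_props(1)[OF assms(2,3)] unfolding missing_def by auto
  show "e = f"
    using * new properD[OF assms(1)] by (metis fun_upd_apply insert_iff)
qed

section \<open>Rotating a fan\<close>

lemma path_transfer:
  assumes "rtrancl_path r a es k" "\<And>a b. r a b \<Longrightarrow> b \<in> set es \<Longrightarrow> s a b"
  shows "rtrancl_path s a es k"
  using assms by induction (auto intro: rtrancl_path.intros)

text \<open>The colour of \<open>k\<close> is missing at the far end of \<open>h\<close> by the fan
  step, and it becomes missing at \<open>x\<close> once \<open>k\<close> gives it up. The uncoloured
  edge thus moves from \<open>h\<close> to \<open>k\<close>.\<close>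

lemma fan_shift:
  assumes "proper F \<phi>" "h \<notin> F" "x \<in> en h" "card (en h) = 2" "fan_step F \<phi> x h k"
  shows "proper (insert h (F - {k})) (\<phi>(h := \<phi> k))"
proof -
  have k: "k \<in> F" "x \<in> en k" "\<phi> k \<in> missing F \<phi> (far x h)"
    using assms(5) unfolding fan_step_def by auto
  have "proper (F - {k}) \<phi>" using assms(1) unfolding proper_def by auto
  moreover have "\<phi> k \<in> missing (F - {k}) \<phi> x" 
    using assms(1) k properD[OF assms(1) _ k(1)] unfolding missing_def by auto
  moreover have "\<phi> k \<in> missing (F - {k}) \<phi> (far x h)"
    using k(3) unfolding missing_def by auto
  ultimately show ?thesis using proper_insert[of "F - {k}" \<phi> h x "\<phi> k"] assms by auto
qed

text \<open>Iterating \<open>fan_shift\<close> along the path makes \<open>k\<close> the uncoloured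
  edge. The last conclusion, that no new colour appears at \<open>x\<close>, is what
  \<open>fan_missing_centre\<close> needs.\<close>

lemma fan_rotate:
  assumes "rtrancl_path (fan_step F \<phi> x) h es k" "distinct (h # es)"
    and "proper F \<phi>" "h \<notin> F" "x \<in> en h" "\<forall>e\<in>insert h F. card (en e) = 2"
  shows "\<exists>\<phi>'. proper (insert h F - {k}) \<phi>' \<and> (\<forall>e. x \<notin> en e \<longrightarrow> \<phi>' e = \<phi> e) \<and>
     \<phi>' ` {e \<in> insert h F - {k}. x \<in> en e} \<subseteq> \<phi> ` {e \<in> F. x \<in> en e}"
  using assms
proof (induction es arbitrary: F \<phi> h)
  case Nil
  from Nil.prems(1) have "k = h" by cases auto
  with Nil have "insert h F - {k} = F" by auto
  with Nil show ?case by (metis order_refl)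
next
  case (Cons a es)
  from Cons.prems(1) have ha: "fan_step F \<phi> x h a" and p: "rtrancl_path (fan_step F \<phi> x) a es k"
    by (cases; simp)+
  then have a: "a \<in> F" "x \<in> en a" unfolding fan_step_def by auto
  define F1 where "F1 = insert h (F - {a})"
  define \<phi>1 where "\<phi>1 = \<phi>(h := \<phi> a)"
  have proper1: "proper F1 \<phi>1"
    unfolding F1_def \<phi>1_def using fan_shift[OF Cons.prems(3-5) _ ha] Cons.prems(6) by auto
  have p1: "rtrancl_path (fan_step F1 \<phi>1 x) a es k"
  \<comment> \<open>The remaining steps survive the shift: distinctness keeps \<open>d\<close> apart
    from \<open>h\<close> and \<open>a\<close>, and the only colour a vertex can newly see is that
    of \<open>a\<close>, which differs from that of \<open>d\<close> because both edges meet at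
    \<open>x\<close>.\<close>
  proof (rule path_transfer[OF p])
    fix c d assume cd: "fan_step F \<phi> x c d" "d \<in> set es"
    with Cons.prems(2) have ne: "d \<noteq> h" "d \<noteq> a" by auto
    have d: "d \<in> F" "x \<in> en d" "\<phi> d \<in> missing F \<phi> (far x c)"
      using cd unfolding fan_step_def by auto
    have "\<phi> d \<noteq> \<phi> a" using properD[OF Cons.prems(3)] a d ne by metis
    then show "fan_step F1 \<phi>1 x c d"
      using d ne unfolding fan_step_def F1_def \<phi>1_def missing_def by auto
  qed
  have "a \<notin> F1" using a Cons.prems(2) unfolding F1_def by auto
  then obtain \<phi>' where \<phi>': "proper (insert a F1 - {k}) \<phi>'" "\<forall>e. x \<notin> en e \<longrightarrow> \<phi>' e = \<phi>1 e"
     "\<phi>' ` {e \<in> insert a F1 - {k}. x \<in> en e} \<subseteq> \<phi>1 ` {e \<in> F1. x \<in> en e}"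
    using Cons.IH[OF p1 _ proper1] Cons.prems(2,6) a unfolding F1_def by auto
  have "insert a F1 = insert h F" using a unfolding F1_def by auto
  moreover have "\<phi>1 ` {e \<in> F1. x \<in> en e} \<subseteq> \<phi> ` {e \<in> F. x \<in> en e}"
    using a Cons.prems(4) unfolding F1_def \<phi>1_def by auto
  moreover have "\<phi>' e = \<phi> e" if "x \<notin> en e" for e
    using that \<phi>'(2) Cons.prems(5) unfolding \<phi>1_def by auto
  ultimately show ?case using \<phi>'(1,3) by (intro exI[of _ \<phi>'] conjI allI impI) auto
qed

lemma fan_rotate_reachable:
  assumes "(fan_step F \<phi> x)\<^sup>*\<^sup>* h k"
    and "proper F \<phi>" "h \<notin> F" "x \<in> en h" "\<forall>e\<in>insert h F. card (en e) = 2"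
  obtains \<phi>' where "proper (insert h F - {k}) \<phi>'" "\<And>e. x \<notin> en e \<Longrightarrow> \<phi>' e = \<phi> e"
     "\<phi>' ` {e \<in> insert h F - {k}. x \<in> en e} \<subseteq> \<phi> ` {e \<in> F. x \<in> en e}"
proof -
  obtain es where "rtrancl_path (fan_step F \<phi> x) h es k"
    using assms(1) rtranclp_eq_rtrancl_path by metis
  then obtain es' where "rtrancl_path (fan_step F \<phi> x) h es' k" "distinct (h # es')"
    by (rule rtrancl_path_distinct)
  from fan_rotate[OF this assms(2-5)] show thesis using that by blast
qed

lemma reachable_edge:
  assumes "(fan_step F \<phi> x)\<^sup>*\<^sup>* h k" "x \<in> en h"
  shows "k \<in> insert h F" "x \<in> en k"
  using assms by (induction) (auto simp: fan_step_def)

text \<open>A common colour \<open>c\<close> would complete the colouring: rotate until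
  \<open>k\<close> is uncoloured and give it \<open>c\<close>. The rotation brings no new colour to
  \<open>x\<close> and changes no edge away from \<open>x\<close>, so \<open>c\<close> stays missing
  at both ends of \<open>k\<close>.\<close>

lemma fan_missing_centre:
  assumes "(fan_step F \<phi> x)\<^sup>*\<^sup>* h k"
    and "proper F \<phi>" "h \<notin> F" "x \<in> en h" "\<forall>e\<in>insert h F. card (en e) = 2"
    and "\<nexists>\<phi>'. proper (insert h F) \<phi>'"
  shows "missing F \<phi> (far x k) \<inter> missing F \<phi> x = {}"
proof (rule ccontr)
  assume "\<not> ?thesis"
  then obtain c where c: "c \<in> missing F \<phi> (far x k)" "c \<in> missing F \<phi> x" by auto
  obtain \<phi>' where \<phi>': "proper (insert h F - {k}) \<phi>'" "\<And>e. x \<notin> en e \<Longrightarrow> \<phi>' e = \<phi> e"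
     "\<phi>' ` {e \<in> insert h F - {k}. x \<in> en e} \<subseteq> \<phi> ` {e \<in> F. x \<in> en e}"
    by (rule fan_rotate_reachable[OF assms(1-5)]) blast
  note k = reachable_edge[OF assms(1,4)]
  have at_x: "\<phi>' e \<noteq> c" if "e \<in> insert h F - {k}" "x \<in> en e" for e
  proof -
    have "\<phi>' e \<in> \<phi> ` {e \<in> F. x \<in> en e}" using that by (intro subsetD[OF \<phi>'(3)] imageI) simp
    then show ?thesis using c(2) unfolding missing_def by auto
  qed
  have "c \<in> missing (insert h F - {k}) \<phi>' x" 
    using c at_x unfolding missing_def by auto
  moreover have "\<phi>' e \<noteq> c" if "e \<in> insert h F - {k}" "far x k \<in> en e" for e
  proof (cases "x \<in> en e")
    case False
    then have "e \<in> F" using that assms(4) by auto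
    then show ?thesis using False that c(1) \<phi>'(2) unfolding missing_def by auto
  qed (use at_x that in auto)
  then have "c \<in> missing (insert h F - {k}) \<phi>' (far x k)" 
    using c unfolding missing_def by auto
  ultimately have "proper (insert k (insert h F - {k})) (\<phi>'(k := c))"
    using proper_insert[OF \<phi>'(1), of k x c] k assms(5) by auto
  moreover have "insert k (insert h F - {k}) = insert h F" using k by auto
  ultimately show False using assms(6) by auto
qed

section \<open>Kempe chains\<close>

text \<open>Following the alternating path from \<open>x\<close> one edge at a time, starting with colour \<open>\<alpha>\<close>, makes the
  vertex reached after \<open>n\<close> steps unique. Hence at most one vertex other than \<open>x\<close> at which \<open>\<alpha>\<close> is missing
  lies on it, without any need to know that the path is simple.\<close>

inductive trail :: "'e set \<Rightarrow> ('e \<Rightarrow> 'c) \<Rightarrow> 'c \<Rightarrow> 'c \<Rightarrow> 'v \<Rightarrow> nat \<Rightarrow> 'v \<Rightarrow> bool"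
  for F \<phi> \<alpha> \<beta> x where
  start: "trail F \<phi> \<alpha> \<beta> x 0 x"
| step: "trail F \<phi> \<alpha> \<beta> x n v \<Longrightarrow> k \<in> F \<Longrightarrow> en k = {v, w} \<Longrightarrow>
    \<phi> k = (if even n then \<alpha> else \<beta>) \<Longrightarrow> trail F \<phi> \<alpha> \<beta> x (Suc n) w"

lemma trail_0D: "trail F \<phi> \<alpha> \<beta> x 0 v \<Longrightarrow> v = x"
  by (cases rule: trail.cases) auto

lemma trail_SucE:
  assumes "trail F \<phi> \<alpha> \<beta> x (Suc n) w"
  obtains v k where "trail F \<phi> \<alpha> \<beta> x n v" "k \<in> F" "en k = {v, w}"
    "\<phi> k = (if even n then \<alpha> else \<beta>)"
  using assms by cases auto

lemma trail_unique:
  assumes "proper F \<phi>" "\<forall>e\<in>F. card (en e) = 2"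
  shows "trail F \<phi> \<alpha> \<beta> x n v \<Longrightarrow> trail F \<phi> \<alpha> \<beta> x n w \<Longrightarrow> v = w"
proof (induction n arbitrary: v w)
  case 0
  then show ?case by (auto dest: trail_0D)
next
  case (Suc n)
  obtain v' k where v': "trail F \<phi> \<alpha> \<beta> x n v'" "k \<in> F" "en k = {v', v}"
    "\<phi> k = (if even n then \<alpha> else \<beta>)" using trail_SucE[OF Suc.prems(1)] by blast
  obtain w' l where w': "trail F \<phi> \<alpha> \<beta> x n w'" "l \<in> F" "en l = {w', w}"
    "\<phi> l = (if even n then \<alpha> else \<beta>)" using trail_SucE[OF Suc.prems(2)] by blast
  have "v' = w'" using Suc.IH v' w' by blast
  then have "k = l" using properD[OF assms(1) v'(2) w'(2), of v'] v' w' by auto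
  then show "v = w" using v' w' \<open>v' = w'\<close> assms(2) by (auto simp: doubleton_eq_iff)
qed

lemma trail_prefix: "trail F \<phi> \<alpha> \<beta> x n v \<Longrightarrow> m \<le> n \<Longrightarrow> \<exists>w. trail F \<phi> \<alpha> \<beta> x m w"
proof (induction rule: trail.induct)
  case start
  then show ?case by (auto intro: trail.start)
next
  case (step n v k w)
  then show ?case by (metis le_Suc_eq trail.step)
qed

text \<open>\<open>S\<close> consists of the vertices on the trail from \<open>x\<close>. If
  \<open>y\<close> and \<open>y'\<close> both lay on it, the trail would stop at each of them, hence
  after the same number of steps, and uniqueness would give \<open>y = y'\<close>.\<close>

lemma kempe_separation:
  assumes "proper F \<phi>" "\<forall>e\<in>F. card (en e) = 2"
    and "\<beta> \<in> missing F \<phi> x" "\<alpha> \<in> missing F \<phi> y" "\<alpha> \<in> missing F \<phi> y'" 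
    and "y \<noteq> y'" "y \<noteq> x" "y' \<noteq> x" "\<alpha> \<noteq> \<beta>"
  obtains S where "x \<in> S" "y \<notin> S \<or> y' \<notin> S"
    "\<And>e. e \<in> F \<Longrightarrow> \<phi> e = \<alpha> \<or> \<phi> e = \<beta> \<Longrightarrow> en e \<inter> S \<noteq> {} \<Longrightarrow> en e \<subseteq> S"
proof -
  define T where "T = trail F \<phi> \<alpha> \<beta> x"
  define S where "S = {v. \<exists>n. T n v}"
  have xS: "x \<in> S" unfolding S_def T_def by (auto intro: trail.start)
  \<comment> \<open>After an even number of steps the trail would have to leave \<open>z\<close> by
    an edge coloured \<alpha>; after an odd number it has entered \<open>z\<close> by one. Neither
    is possible.\<close>
  have no_succ: "\<not> T (Suc n) w" if z: "T n z" "\<alpha> \<in> missing F \<phi> z" "z \<noteq> x" for n z w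
  proof
    assume "T (Suc n) w"
    then obtain v k where v: "T n v" "k \<in> F" "en k = {v, w}" "\<phi> k = (if even n then \<alpha> else \<beta>)"
      unfolding T_def by (rule trail_SucE)
    have vz: "v = z" using trail_unique[OF assms(1,2)] v(1) z(1) unfolding T_def by blast
    have odd: "odd n" using v z(2) vz unfolding missing_def by auto
    then obtain m where m: "n = Suc m" by (cases n) auto
    then obtain v' l where "l \<in> F" "en l = {v', z}" "\<phi> l = (if even m then \<alpha> else \<beta>)"
      using trail_SucE[OF z(1)[unfolded T_def m]] by metis
    then show False using z(2) odd m unfolding missing_def by auto
  qed
  have "\<not> (y \<in> S \<and> y' \<in> S)"
  proof
    assume "y \<in> S \<and> y' \<in> S"
    then obtain n m where nm: "T n y" "T m y'" unfolding S_def by auto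
    have "\<not> n < m" using no_succ[OF nm(1)] assms(4,7) nm(2) trail_prefix[of F \<phi> \<alpha> \<beta> x m y' "Suc n"]
      unfolding T_def by auto
    moreover have "\<not> m < n" using no_succ[OF nm(2)] assms(5,8) nm(1) trail_prefix[of F \<phi> \<alpha> \<beta> x n y "Suc m"]
      unfolding T_def by auto
    ultimately have "n = m" by auto
    then show False using nm trail_unique[OF assms(1,2)] assms(6) unfolding T_def by blast
  qed
  moreover have "en e \<subseteq> S" if e: "e \<in> F" "\<phi> e = \<alpha> \<or> \<phi> e = \<beta>" "en e \<inter> S \<noteq> {}" for e
  proof -
    obtain v n where v: "v \<in> en e" "T n v" using e(3) unfolding S_def by auto
    obtain w where w: "en e = {v, w}" using far_props(1)[of e v] assms(2) e(1) v(1) by blast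
    have "w \<in> S"
    proof (cases "\<phi> e = (if even n then \<alpha> else \<beta>)")
      case True
      then show ?thesis using trail.step[of F \<phi> \<alpha> \<beta> x n v e w] e v w unfolding S_def T_def by auto
    next
      \<comment> \<open>Now \<open>e\<close> does not have the colour of the next step. At the start
        its colour is \<beta>, which is missing at \<open>x\<close>; later it is the colour of the
        edge by which the trail entered \<open>v\<close>, so \<open>e\<close> leads back.\<close>
      case False
      show ?thesis
      proof (cases n)
        case 0
        then have "v = x" using v unfolding T_def by (auto dest: trail_0D)
        then show ?thesis using False 0 e v assms(3) unfolding missing_def by auto
      next
        case (Suc m)
        then obtain v' l where l: "T m v'" "l \<in> F" "en l = {v', v}" "\<phi> l = (if even m then \<alpha> else \<beta>)"
          using trail_SucE[OF v(2)[unfolded T_def Suc], folded T_def] by metis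
        have "\<phi> l = \<phi> e" using l False Suc e(2) by (auto split: if_splits)
        then have "l = e" using properD[OF assms(1) l(2) e(1), of v] l v by auto
        then have "w = v'" using l w assms(2) e(1) by (auto simp: doubleton_eq_iff)
        then show ?thesis using l unfolding S_def by auto
      qed
    qed
    then show ?thesis using w v unfolding S_def by auto
  qed
  ultimately show thesis using that[OF xS] by blast
qed

text \<open>The colours are exchanged on everything outside \<open>S\<close>, which leaves all edges at the centre of
  a fan inside \<open>S\<close> unchanged.\<close>

lemma kempe_swap:
  assumes "proper F \<phi>" "\<alpha> \<in> C" "\<beta> \<in> C"
    and "\<And>e. e \<in> F \<Longrightarrow> \<phi> e = \<alpha> \<or> \<phi> e = \<beta> \<Longrightarrow> en e \<inter> S \<noteq> {} \<Longrightarrow> en e \<subseteq> S"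
  defines "\<phi>' \<equiv> \<lambda>e. if en e \<inter> S \<noteq> {} then \<phi> e else transpose \<alpha> \<beta> (\<phi> e)"
  shows "proper F \<phi>'"
    and "v \<in> S \<Longrightarrow> missing F \<phi>' v = missing F \<phi> v"
    and "v \<notin> S \<Longrightarrow> missing F \<phi>' v = transpose \<alpha> \<beta> ` missing F \<phi> v"
proof -
  have inC: "transpose \<alpha> \<beta> c \<in> C \<longleftrightarrow> c \<in> C" for c
    using assms(2,3) by (auto simp: transpose_def)
  have inS: "\<phi>' e = \<phi> e" if "v \<in> S" "v \<in> en e" for v e
    using that unfolding \<phi>'_def by auto
  have outS: "\<phi>' e = transpose \<alpha> \<beta> (\<phi> e)" if "v \<notin> S" "v \<in> en e" "e \<in> F" for v e
    using that assms(4)[of e] unfolding \<phi>'_def by (auto simp: transpose_def)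
  show "proper F \<phi>'"
  proof (rule properI)
    fix e assume "e \<in> F"
    then show "\<phi>' e \<in> C" using assms(1) inC unfolding \<phi>'_def proper_def by auto
  next
    fix e f v assume *: "e \<in> F" "f \<in> F" "v \<in> en e" "v \<in> en f" "\<phi>' e = \<phi>' f"
    then have "\<phi> e = \<phi> f"
      using inS[of v] outS[of v] by (cases "v \<in> S") (auto dest: injD[OF inj_transpose])
    then show "e = f" using * properD[OF assms(1)] by blast
  qed
  show "v \<in> S \<Longrightarrow> missing F \<phi>' v = missing F \<phi> v"
    using inS unfolding missing_def by auto
  show "missing F \<phi>' v = transpose \<alpha> \<beta> ` missing F \<phi> v" if "v \<notin> S"
  proof -
    have "c \<in> missing F \<phi>' v \<longleftrightarrow> transpose \<alpha> \<beta> c \<in> missing F \<phi> v" for c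
    proof -
      have "\<phi>' e \<noteq> c \<longleftrightarrow> \<phi> e \<noteq> transpose \<alpha> \<beta> c" if "e \<in> F" "v \<in> en e" for e
        using outS[OF \<open>v \<notin> S\<close> that(2,1)] by (metis transpose_involutory)
      then show ?thesis using inC unfolding missing_def by auto
    qed
    then show ?thesis by (metis (no_types, opaque_lifting) image_iff set_eqI transpose_involutory)
  qed
qed

text \<open>If \<alpha> is missing at two fan vertices and \<beta> at \<open>x\<close>, one of the
  two is not on the chain of \<open>x\<close>. Exchanging the colours off that chain makes \<beta>
  missing at a fan vertex while it stays missing at \<open>x\<close>, against
  \<open>fan_missing_centre\<close>.\<close>

lemma fan_missing_disjoint:
  assumes "(fan_step F \<phi> x)\<^sup>*\<^sup>* h k" "(fan_step F \<phi> x)\<^sup>*\<^sup>* h k'"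
    and "proper F \<phi>" "h \<notin> F" "x \<in> en h" "\<forall>e\<in>insert h F. card (en e) = 2"
    and "\<nexists>\<phi>'. proper (insert h F) \<phi>'"
    and "far x k \<noteq> far x k'" "missing F \<phi> x \<noteq> {}"
  shows "missing F \<phi> (far x k) \<inter> missing F \<phi> (far x k') = {}"
proof (rule ccontr)
  assume "\<not> ?thesis"
  then obtain \<alpha> where \<alpha>: "\<alpha> \<in> missing F \<phi> (far x k)" "\<alpha> \<in> missing F \<phi> (far x k')" by auto
  obtain \<beta> where \<beta>: "\<beta> \<in> missing F \<phi> x" using assms(9) by auto
  have "\<alpha> \<noteq> \<beta>" using fan_missing_centre[OF assms(1,3-7)] \<alpha> \<beta> by auto
  have C: "\<alpha> \<in> C" "\<beta> \<in> C" using \<alpha> \<beta> unfolding missing_def by auto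
  note kx = reachable_edge[OF assms(1,5)] reachable_edge[OF assms(2,5)]
  obtain S where S: "x \<in> S" "far x k \<notin> S \<or> far x k' \<notin> S"
    "\<And>e. e \<in> F \<Longrightarrow> \<phi> e = \<alpha> \<or> \<phi> e = \<beta> \<Longrightarrow> en e \<inter> S \<noteq> {} \<Longrightarrow> en e \<subseteq> S"
  proof (rule kempe_separation[OF assms(3) _ \<beta> \<alpha> assms(8) _ _ \<open>\<alpha> \<noteq> \<beta>\<close>])
    show "\<forall>e\<in>F. card (en e) = 2" "far x k \<noteq> x" "far x k' \<noteq> x"
      using assms(6) far_props(2) kx by auto
  qed blast
  define \<phi>' where "\<phi>' = (\<lambda>e. if en e \<inter> S \<noteq> {} then \<phi> e else transpose \<alpha> \<beta> (\<phi> e))"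
  note swap = kempe_swap[OF assms(3) C S(3), folded \<phi>'_def]
  \<comment> \<open>The swap breaks a fan path only after a vertex satisfying \<open>P\<close>, where the path may just as well end.\<close>
  define P where "P a \<longleftrightarrow> \<alpha> \<in> missing F \<phi> (far x a) \<and> far x a \<notin> S" for a
  have reach: "(fan_step F \<phi>' x)\<^sup>*\<^sup>* h l \<or> (\<exists>a. P a \<and> (fan_step F \<phi>' x)\<^sup>*\<^sup>* h a)"
    if "(fan_step F \<phi> x)\<^sup>*\<^sup>* h l" for l
    using that
  proof induction
    case (step l m)
    show ?case
    proof (cases "\<exists>a. P a \<and> (fan_step F \<phi>' x)\<^sup>*\<^sup>* h a")
      case False
      with step have l: "(fan_step F \<phi>' x)\<^sup>*\<^sup>* h l" "\<not> P l" by auto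
      have m: "m \<in> F" "x \<in> en m" "\<phi> m \<in> missing F \<phi> (far x l)"
        using step.hyps(2) unfolding fan_step_def by auto
      have "\<phi>' m = \<phi> m" using m S(1) unfolding \<phi>'_def by auto
      moreover have "\<phi> m \<in> missing F \<phi>' (far x l)"
      proof (cases "far x l \<in> S")
        case False
        then have "\<phi> m \<noteq> \<alpha>" using l(2) m(3) unfolding P_def by auto
        moreover have "\<phi> m \<noteq> \<beta>" using m \<beta> unfolding missing_def by auto
        ultimately have "transpose \<alpha> \<beta> (\<phi> m) = \<phi> m" by (simp add: transpose_def)
        then show ?thesis using swap(3)[of "far x l"] False m(3) by (metis image_eqI)
      qed (use swap(2) m(3) in auto)
      ultimately have "fan_step F \<phi>' x l m" using m unfolding fan_step_def by auto
      then show ?thesis using l by auto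
    qed auto
  qed auto
  have "\<exists>l. P l \<and> (fan_step F \<phi> x)\<^sup>*\<^sup>* h l" using S(2) \<alpha> assms(1,2) unfolding P_def by auto
  then obtain a where a: "P a" "(fan_step F \<phi>' x)\<^sup>*\<^sup>* h a" using reach by blast
  \<comment> \<open>Outside \<open>S\<close> the exchange turns the missing \<alpha> into a missing
    \<beta>.\<close>
  have "\<beta> \<in> missing F \<phi>' (far x a)" using a(1) swap(3) unfolding P_def by force
  moreover have "\<beta> \<in> missing F \<phi>' x" using swap(2) S(1) \<beta> by auto
  ultimately show False using fan_missing_centre[OF a(2) swap(1) assms(4-7)] by auto
qed

section \<open>Counting missing colours around a fan\<close>

text \<open>If the fan cannot be completed, then the colours missing at its vertices are pairwise distinct and
  all occur at \<open>x\<close> on edges of the fan other than \<open>h\<close>; there are too few such edges for every fan vertex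
  \<open>y\<close> to miss as many colours as there are edges \<open>xy\<close>.\<close>

lemma deficient_fan_vertex:
  assumes "proper F \<phi>" "h \<notin> F" "x \<in> en h" "\<forall>e\<in>insert h F. card (en e) = 2"
    and "\<nexists>\<phi>'. proper (insert h F) \<phi>'" "missing F \<phi> x \<noteq> {}" "finite F"
  obtains k t \<phi>' where "k \<in> insert h F" "en k = {x, t}" "t \<noteq> x"
    "card (missing F \<phi> t) < card {e \<in> insert h F. en e = {x, t}}"
    "proper (insert h F - {k}) \<phi>'" "\<And>e. x \<notin> en e \<Longrightarrow> \<phi>' e = \<phi> e"
proof -
  define R where "R = {k. (fan_step F \<phi> x)\<^sup>*\<^sup>* h k}"
  define Y where "Y = far x ` R"
  have R: "k \<in> insert h F" "x \<in> en k" "en k = {x, far x k}" "far x k \<noteq> x" if "k \<in> R" for k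
  proof -
    show k: "k \<in> insert h F" "x \<in> en k"
      using reachable_edge[of F \<phi> x h k] that assms(3) unfolding R_def by blast+
    show "en k = {x, far x k}" "far x k \<noteq> x" using far_props[of k x] k assms(4) by auto
  qed
  have finR: "finite R" using R(1) assms(7) by (meson finite_insert finite_subset subsetI)
  have hR: "h \<in> R" unfolding R_def by auto
  have sub: "(\<Union>y\<in>Y. missing F \<phi> y) \<subseteq> \<phi> ` (R - {h})"
  proof
    fix c assume "c \<in> (\<Union>y\<in>Y. missing F \<phi> y)"
    then obtain a where a: "a \<in> R" "c \<in> missing F \<phi> (far x a)" unfolding Y_def by auto
    then have "c \<notin> missing F \<phi> x" 
      using fan_missing_centre[of F \<phi> x h a] assms(1-5) unfolding R_def by blast
    then obtain b where b: "b \<in> F" "x \<in> en b" "\<phi> b = c" using a unfolding missing_def by auto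
    then have "fan_step F \<phi> x a b" using a unfolding fan_step_def by auto
    then have "b \<in> R" using a unfolding R_def by auto
    then show "c \<in> \<phi> ` (R - {h})" using b assms(2) by auto
  qed
  have finU: "finite (\<Union>y\<in>Y. missing F \<phi> y)" using finite_subset[OF sub] finR by simp
  have "(\<Sum>y\<in>Y. card (missing F \<phi> y)) = card (\<Union>y\<in>Y. missing F \<phi> y)"
  proof (rule card_UN_disjoint[symmetric])
    show "finite Y" unfolding Y_def using finR by auto
    show "\<forall>i\<in>Y. finite (missing F \<phi> i)" using finU by (meson UN_upper finite_subset)
    show "\<forall>i\<in>Y. \<forall>j\<in>Y. i \<noteq> j \<longrightarrow> missing F \<phi> i \<inter> missing F \<phi> j = {}"
      using fan_missing_disjoint[of F \<phi> x h] assms(1-6) unfolding Y_def R_def by blast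
  qed
  also have "\<dots> \<le> card (R - {h})" using sub finR by (meson finite_Diff surj_card_le)
  also have "\<dots> < card R" using hR finR by (meson card_Diff1_less)
  also have "\<dots> \<le> (\<Sum>y\<in>Y. card {e \<in> insert h F. en e = {x, y}})"
  proof -
    have "R \<subseteq> (\<Union>y\<in>Y. {e \<in> insert h F. en e = {x, y}})" using R unfolding Y_def by blast
    then have "card R \<le> card (\<Union>y\<in>Y. {e \<in> insert h F. en e = {x, y}})"
      using finR assms(7) unfolding Y_def by (intro card_mono) auto
    also have "\<dots> \<le> (\<Sum>y\<in>Y. card {e \<in> insert h F. en e = {x, y}})"
      using finR unfolding Y_def by (intro card_UN_le) auto
    finally show ?thesis .
  qed
  finally obtain t where t: "t \<in> Y" 
    "card (missing F \<phi> t) < card {e \<in> insert h F. en e = {x, t}}"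
    by (meson not_le sum_mono)
  then obtain k where k: "k \<in> R" "t = far x k" unfolding Y_def by auto
  obtain \<phi>' where "proper (insert h F - {k}) \<phi>'" "\<And>e. x \<notin> en e \<Longrightarrow> \<phi>' e = \<phi> e"
    by (rule fan_rotate_reachable[OF _ assms(1-4), of k]) (use k(1) in \<open>auto simp: R_def\<close>)
  then show thesis using that[of k t] R[OF k(1)] k t by auto
qed

lemma card_missing:
  assumes "finite C" "finite F"
  shows "card C \<le> card (missing F \<phi> v) + card {e \<in> F. v \<in> en e}"
proof -
  have "C \<subseteq> missing F \<phi> v \<union> \<phi> ` {e \<in> F. v \<in> en e}" unfolding missing_def by auto
  then have "card C \<le> card (missing F \<phi> v \<union> \<phi> ` {e \<in> F. v \<in> en e})"
    using assms by (intro card_mono) (auto simp: missing_def)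
  also have "\<dots> \<le> card (missing F \<phi> v) + card {e \<in> F. v \<in> en e}"
    using assms card_Un_le[of "missing F \<phi> v" "\<phi> ` {e \<in> F. v \<in> en e}"]
      card_image_le[of "{e \<in> F. v \<in> en e}" \<phi>] by auto
  finally show ?thesis .
qed

section \<open>Matchings\<close>

definition matching :: "'e set \<Rightarrow> bool" where
  "matching N \<longleftrightarrow> (\<forall>e\<in>N. \<forall>f\<in>N. e \<noteq> f \<longrightarrow> en e \<inter> en f = {})"

definition covered :: "'e set \<Rightarrow> 'v \<Rightarrow> bool" where
  "covered N v \<longleftrightarrow> (\<exists>e\<in>N. v \<in> en e)"

lemma matchingD: "matching N \<Longrightarrow> e \<in> N \<Longrightarrow> f \<in> N \<Longrightarrow> v \<in> en e \<Longrightarrow> v \<in> en f \<Longrightarrow> e = f"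
  unfolding matching_def by blast

lemma matching_insert:
  "matching N \<Longrightarrow> \<forall>v\<in>en k. \<not> covered N v \<Longrightarrow> matching (insert k N)"
  unfolding matching_def covered_def by blast

end

section \<open>The theorem of Berge and Fournier\<close>

text \<open>\<open>C\<close> may be one colour short of Vizing's bound for multigraphs; the colour
  held back is meant for a matching.\<close>

locale bounded_multigraph = edge_palette en C
  for en :: "'e \<Rightarrow> 'v set" and C :: "'c set" +
  fixes E :: "'e set" and \<Delta> \<mu> :: nat
  assumes finE: "finite E" and ends2: "\<forall>e\<in>E. card (en e) = 2"
    and deg: "card {e \<in> E. v \<in> en e} \<le> \<Delta>"
    and mult: "card {e \<in> E. en e = {u, v}} \<le> \<mu>"
    and finC: "finite C" and palette: "\<Delta> + \<mu> \<le> Suc (card C)"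
begin

text \<open>At most \<open>\<Delta> - 1\<close> edges at an end of an uncoloured edge are coloured,
  and \<open>C\<close> has at least \<open>\<Delta> + \<mu> - 1\<close> colours.\<close>

lemma missing_ge:
  assumes "F \<subseteq> E" "e \<in> E - F" "v \<in> en e"
  shows "\<mu> \<le> card (missing F \<phi> v)"
proof -
  have "{e \<in> F. v \<in> en e} \<subset> {e \<in> E. v \<in> en e}" using assms by auto
  then have "card {e \<in> F. v \<in> en e} < card {e \<in> E. v \<in> en e}"
    using finE by (intro psubset_card_mono) auto
  then have "card {e \<in> F. v \<in> en e} < \<Delta>" using deg[of v] by simp
  moreover have "card C \<le> card (missing F \<phi> v) + card {e \<in> F. v \<in> en e}"
    using card_missing finC finite_subset[OF assms(1) finE] by blast
  ultimately show ?thesis using palette by simp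
qed

text \<open>The deficient fan vertex \<open>t\<close> misses fewer than \<mu> colours, so by
  \<open>missing_ge\<close> no uncoloured edge ends there; in particular \<open>k\<close> is not
  \<open>h\<close>. For \<open>F = E - N\<close> this says that \<open>N\<close> does not cover
  \<open>t\<close>.\<close>

lemma shift_to_saturated:
  assumes "F \<subseteq> E" "h \<in> E - F" "x \<in> en h" "proper F \<phi>" "\<nexists>\<phi>'. proper (insert h F) \<phi>'"
  obtains k t \<phi>' where "k \<in> F" "en k = {x, t}" "t \<noteq> x" "\<And>e. e \<in> E - F \<Longrightarrow> t \<notin> en e"
    "proper (insert h F - {k}) \<phi>'" "\<And>e. x \<notin> en e \<Longrightarrow> \<phi>' e = \<phi> e"
proof -
  have finF: "finite F" using finite_subset[OF assms(1) finE] .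
  \<comment> \<open>The edge \<open>h\<close> itself shows that \<mu> is positive, so some colour is
    missing at \<open>x\<close>.\<close>
  have "{e \<in> E. en e = {x, far x h}} \<noteq> {}" using far_props[of h x] assms ends2 by auto
  then have "0 < card {e \<in> E. en e = {x, far x h}}" using finE by (simp add: card_gt_0_iff)
  then have "0 < card (missing F \<phi> x)"
    using mult[of x "far x h"] missing_ge[OF assms(1-3), of \<phi>] by linarith
  then have ne: "missing F \<phi> x \<noteq> {}" by auto
  have two: "\<forall>e\<in>insert h F. card (en e) = 2" using assms ends2 by auto
  obtain k t \<phi>' where k: "k \<in> insert h F" "en k = {x, t}" "t \<noteq> x"
    "card (missing F \<phi> t) < card {e \<in> insert h F. en e = {x, t}}"
    "proper (insert h F - {k}) \<phi>'" "\<And>e. x \<notin> en e \<Longrightarrow> \<phi>' e = \<phi> e"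
    using deficient_fan_vertex[OF assms(4) _ assms(3) two assms(5) ne finF] assms(2) by blast
  have "card {e \<in> insert h F. en e = {x, t}} \<le> card {e \<in> E. en e = {x, t}}"
    using assms finE by (intro card_mono) auto
  then have "card (missing F \<phi> t) < \<mu>" using k(4) mult[of x t] by linarith
  then have sat: "t \<notin> en e" if "e \<in> E - F" for e
    using missing_ge[OF assms(1) that, of t \<phi>] by auto
  then have "k \<in> F" using k(1,2) assms(2) by auto
  then show thesis using that k sat by blast
qed

text \<open>Edges of \<open>A\<close> are added one at a time. A failure would yield a saturated
  neighbour \<open>t\<close> of \<open>x\<close>, but the hypothesis leaves at \<open>t\<close> an
  edge that is never coloured. It refers to the fixed set \<open>B\<close> so that it survives the
  induction.\<close>

lemma colour_more:
  assumes "finite A" "A \<subseteq> B" "F \<union> B \<subseteq> E" "proper F \<phi>"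
    and "\<And>h. h \<in> B \<Longrightarrow> \<exists>x\<in>en h. \<forall>k\<in>F \<union> B. \<forall>t. en k = {x, t} \<longrightarrow> (\<exists>e\<in>E - (F \<union> B). t \<in> en e)"
  shows "\<exists>\<phi>'. proper (F \<union> A) \<phi>'"
  using assms(1,2)
proof induction
  case empty
  then show ?case using assms(4) by auto
next
  case (insert h A)
  then obtain \<phi>' where \<phi>': "proper (F \<union> A) \<phi>'" by auto
  show ?case
  proof (cases "h \<in> F")
    case True
    then show ?thesis using \<phi>' by (metis Un_insert_right insert_absorb UnI1)
  next
    case False
    obtain x where x: "x \<in> en h" 
      "\<forall>k\<in>F \<union> B. \<forall>t. en k = {x, t} \<longrightarrow> (\<exists>e\<in>E - (F \<union> B). t \<in> en e)"
      using assms(5)[of h] insert.prems by auto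
    show ?thesis
    proof (rule ccontr)
      assume "\<not> ?thesis"
      then have no: "\<nexists>\<phi>'. proper (insert h (F \<union> A)) \<phi>'" by simp
      have sub: "F \<union> A \<subseteq> E" "h \<in> E - (F \<union> A)" using assms(3) insert False by auto
      obtain k t where k: "k \<in> F \<union> A" "en k = {x, t}" "\<And>e. e \<in> E - (F \<union> A) \<Longrightarrow> t \<notin> en e"
        by (rule shift_to_saturated[OF sub x(1) \<phi>' no]) blast
      moreover have "k \<in> F \<union> B" using k insert.prems by auto
      ultimately obtain e where "e \<in> E - (F \<union> B)" "t \<in> en e" using x(2) by blast
      then show False using k(3)[of e] insert.prems by auto
    qed
  qed
qed

text \<open>For a maximal matching the uncovered vertices are independent. The edges between covered vertices are
  coloured first; every other edge is then added with its uncovered end as the centre of the fan.\<close>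

lemma berge_fournier:
  assumes "M \<subseteq> E" "matching M"
  obtains N \<phi> where "M \<subseteq> N" "N \<subseteq> E" "matching N" "proper (E - N) \<phi>"
proof -
  define \<N> where "\<N> = {N. M \<subseteq> N \<and> N \<subseteq> E \<and> matching N}"
  have "finite \<N>" unfolding \<N>_def using finE by (auto intro: finite_subset[of _ "Pow E"])
  moreover have "M \<in> \<N>" unfolding \<N>_def using assms by auto
  ultimately obtain N where N: "N \<in> \<N>" "\<And>N'. N' \<in> \<N> \<Longrightarrow> N \<subseteq> N' \<Longrightarrow> N = N'"
    using finite_has_maximal2[of \<N> M] by auto
  have NE: "M \<subseteq> N" "N \<subseteq> E" "matching N" using N(1) unfolding \<N>_def by auto
  have edge_covered: "covered N x \<or> covered N t" if "k \<in> E - N" "en k = {x, t}" for k x t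
  proof (rule ccontr)
    assume "\<not> ?thesis"
    then have "matching (insert k N)" using that NE(3) by (intro matching_insert) auto
    then have "insert k N \<in> \<N>" using NE that unfolding \<N>_def by auto
    then show False using N(2)[of "insert k N"] that by auto
  qed
  define B where "B = {e \<in> E - N. \<forall>v\<in>en e. covered N v}"
  have BE: "B \<subseteq> E" "B \<subseteq> E - N" unfolding B_def by auto
  have "\<exists>\<phi>. proper ({} \<union> B) \<phi>"
  proof (rule colour_more[where B = B])
    show "finite B" using finite_subset[OF BE(1) finE] .
    fix h assume h: "h \<in> B"
    then have "card (en h) = 2" using BE ends2 by auto
    then obtain x where "x \<in> en h" by fastforce
    \<comment> \<open>The vertex \<open>t\<close> is covered, and the edge of \<open>N\<close>
      covering it stays uncoloured.\<close>
    moreover have "\<exists>e\<in>E - ({} \<union> B). t \<in> en e" if "k \<in> B" "en k = {x, t}" for k t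
      using that NE(2) unfolding B_def covered_def by blast
    ultimately show "\<exists>x\<in>en h. \<forall>k\<in>{} \<union> B. \<forall>t. en k = {x, t} \<longrightarrow> (\<exists>e\<in>E - ({} \<union> B). t \<in> en e)"
      by (intro bexI[of _ x]) auto
  qed (use BE in \<open>auto simp: proper_def\<close>)
  then obtain \<phi>0 where \<phi>0: "proper B \<phi>0" by auto
  have all: "B \<union> (E - N - B) = E - N" using BE by auto
  have "\<exists>\<phi>. proper (B \<union> (E - N - B)) \<phi>"
  proof (rule colour_more[where B = "E - N - B" and \<phi> = \<phi>0])
    fix h assume h: "h \<in> E - N - B"
    then obtain x where x: "x \<in> en h" "\<not> covered N x" unfolding B_def by auto
    have "\<exists>e\<in>E - (E - N). t \<in> en e" if "k \<in> E - N" "en k = {x, t}" for k t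
      using edge_covered[OF that] x(2) NE(2) unfolding covered_def by auto
    then show "\<exists>x\<in>en h. \<forall>k\<in>B \<union> (E - N - B). \<forall>t. en k = {x, t} \<longrightarrow>
        (\<exists>e\<in>E - (B \<union> (E - N - B)). t \<in> en e)"
      unfolding all using x(1) by (intro bexI[of _ x]) auto
  qed (use BE finE \<phi>0 in auto)
  then show thesis using that NE unfolding all by auto
qed

text \<open>Vertices may repeat, so consecutive edges form a walk without any distinctness check;
  \<open>walk_imp_path\<close> recovers paths.\<close>

inductive walk :: "nat \<Rightarrow> 'v \<Rightarrow> 'v \<Rightarrow> bool" where
  walk_refl: "walk 0 u u"
| walk_step: "k \<in> E \<Longrightarrow> en k = {u, w} \<Longrightarrow> walk n w v \<Longrightarrow> walk (Suc n) u v"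

end

section \<open>Precoloured edges far apart\<close>

text \<open>Distance is expressed by walks, and a 5-cycle by its end sets alone, so that no choice
  among parallel edges is needed.\<close>

locale sparse_precolouring = bounded_multigraph en C E \<Delta> \<mu>
  for en :: "'e \<Rightarrow> 'v set" and C :: "'c set" and E \<Delta> \<mu> +
  fixes M :: "'e set" and \<psi> :: "'e \<Rightarrow> 'c" and z :: 'c
  assumes ME: "M \<subseteq> E" and z_new: "z \<notin> C" and \<psi>_in: "e \<in> M \<Longrightarrow> \<psi> e \<in> insert z C"
    and apart: "e \<in> M \<Longrightarrow> f \<in> M \<Longrightarrow> u \<in> en e \<Longrightarrow> v \<in> en f \<Longrightarrow> walk n u v \<Longrightarrow> n \<le> 4 \<Longrightarrow> e = f"
    and no_5_cycle: "distinct [a, b, c, d, v] \<Longrightarrow> {{a, b}, {b, c}, {c, d}, {d, v}, {v, a}} \<subseteq> en ` E \<Longrightarrow> False"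
begin

definition state :: "'e set \<Rightarrow> ('e \<Rightarrow> 'c) \<Rightarrow> bool" where
  "state N \<phi> \<longleftrightarrow> M \<subseteq> N \<and> N \<subseteq> E \<and> matching N \<and> proper (E - N) \<phi>"

text \<open>The size of this set is the quantity maximised in \<open>optimal_state\<close>.\<close>

definition good :: "'e set \<Rightarrow> ('e \<Rightarrow> 'c) \<Rightarrow> ('e \<times> 'v) set" where
  "good N \<phi> = {(e, u). e \<in> M \<and> u \<in> en e \<and>
     (\<exists>f w. f \<in> E - N \<and> \<phi> f = \<psi> e \<and> en f = {u, w} \<and> \<not> covered N w)}"

lemma state_exists: obtains N \<phi> where "state N \<phi>"
proof -
  have "matching M" unfolding matching_def using apart[OF _ _ _ _ walk_refl] by blast
  from berge_fournier[OF ME this] show thesis using that unfolding state_def by metis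
qed

text \<open>The exchange replaces \<open>h\<close> by \<open>k\<close> in the matching. Every
  recoloured edge other than \<open>h\<close> and \<open>k\<close> meets \<open>x\<close>, which is
  covered by \<open>N\<close> but not by \<open>M\<close>; hence edges witnessing good ends keep
  their colours, and only the newly covered \<open>t\<close> could do harm.\<close>

lemma good_increase:
  assumes "state N \<phi>" "\<forall>N' \<phi>'. state N' \<phi>' \<longrightarrow> card N \<le> card N'"
    and e: "e \<in> M" "u \<in> en e" and f: "f \<in> E - N" "\<phi> f = \<psi> e" "en f = {u, u'}"
    and u': "covered N u'" "u' \<notin> en e"
  obtains N' \<phi>' where "state N' \<phi>'" "card N' = card N" "good N \<phi> \<subset> good N' \<phi>'"
proof -
  have N: "M \<subseteq> N" "N \<subseteq> E" "matching N" "proper (E - N) \<phi>" using assms(1) unfolding state_def by auto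
  have finN: "finite N" using finite_subset[OF N(2) finE] .
  obtain h where h: "h \<in> N" "u' \<in> en h" using u'(1) unfolding covered_def by auto
  have hE: "h \<in> E" using h N by auto
  define x where "x = far u' h"
  have x: "en h = {u', x}" "x \<noteq> u'" using far_props[of h u'] ends2 hE h unfolding x_def by auto
  have he: "h \<noteq> e" using h u' by auto
  have uu': "walk (Suc 0) u u'" using f by (intro walk_step[of f]) (auto intro: walk_refl)
  \<comment> \<open>One end of \<open>h\<close> is a single step away from \<open>e\<close>.\<close>
  have hM: "h \<notin> M" using apart[OF e(1) _ e(2) h(2) uu'] he by auto
  have disj: "v \<notin> en h" if "e' \<in> M" "v \<in> en e'" for e' v
    using matchingD[OF N(3) h(1), of e' v] that N(1) hM by auto
  \<comment> \<open>Otherwise \<open>h\<close> could leave the matching, against the minimality of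
    \<open>N\<close>.\<close>
  have "\<nexists>\<phi>'. proper (insert h (E - N)) \<phi>'"
  proof
    assume "\<exists>\<phi>'. proper (insert h (E - N)) \<phi>'"
    then obtain \<phi>' where "proper (insert h (E - N)) \<phi>'" by auto
    moreover have "insert h (E - N) = E - (N - {h})" using hE by auto
    ultimately have "state (N - {h}) \<phi>'" using N hM unfolding state_def matching_def by auto
    then have "card N \<le> card (N - {h})" using assms(2) by auto
    then show False using h(1) finN by (meson card_Diff1_less not_le)
  qed
  moreover have "h \<in> E - (E - N)" using h hE by auto
  ultimately obtain k t \<phi>' where k: "k \<in> E - N" "en k = {x, t}" "t \<noteq> x"
    "\<And>e. e \<in> E - (E - N) \<Longrightarrow> t \<notin> en e"
    "proper (insert h (E - N) - {k}) \<phi>'" "\<And>e. x \<notin> en e \<Longrightarrow> \<phi>' e = \<phi> e"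
    using shift_to_saturated[of "E - N" h x \<phi>] x N(4) by blast
  have t: "\<not> covered N t" using k(4) N(2) unfolding covered_def by auto
  define N' where "N' = insert k (N - {h})"
  have E': "E - N' = insert h (E - N) - {k}" using hE k(1) h(1) unfolding N'_def by auto
  have cov: "\<not> covered (N - {h}) v" if "v \<in> en h" for v
    using that h(1) matchingD[OF N(3)] unfolding covered_def by blast
  have "matching (N - {h})" using N(3) unfolding matching_def by auto
  then have "matching N'" unfolding N'_def
    using k(2) t cov[of x] x by (intro matching_insert) (auto simp: covered_def)
  then have st: "state N' \<phi>'" using N hM k(1,5) unfolding state_def E'[symmetric] N'_def by auto
  have card': "card N' = card N" using h(1) k(1) finN unfolding N'_def
    by (simp add: card.insert_remove) (metis Suc_pred card_gt_0_iff empty_iff)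
  have cov': "\<not> covered N' v" if "\<not> covered N v" "v \<noteq> t" for v
    using that h(1) x k(2) unfolding covered_def N'_def by auto
  have tu': "t \<noteq> u'" and tM: "\<And>e v. e \<in> M \<Longrightarrow> v \<in> en e \<Longrightarrow> v \<noteq> t"
    using t u'(1) N(1) unfolding covered_def by auto
  have keep: "f' \<in> E - N' \<and> \<phi>' f' = \<phi> f'" if "f' \<in> E - N" "x \<notin> en f'" for f'
    using that k E' by auto
  have xf: "x \<notin> en f" using x disj[OF e] f by auto
  have "\<not> covered N' u'" using cov[OF h(2)] k(2) x tu' unfolding covered_def N'_def by auto
  then have new: "(e, u) \<in> good N' \<phi>'" using e f keep[OF f(1) xf] unfolding good_def by auto
  have same: "f2 = f" if "f2 \<in> E - N" "\<phi> f2 = \<psi> e" "u \<in> en f2" for f2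
    using properD[OF N(4) that(1) f(1) that(3)] that f by auto
  \<comment> \<open>By properness \<open>f\<close> is the only edge at \<open>u\<close> with colour
    \<open>\<psi> e\<close>, and both of its ends are covered.\<close>
  have old: "(e, u) \<notin> good N \<phi>"
  proof
    assume "(e, u) \<in> good N \<phi>"
    then obtain f2 w where f2: "f2 \<in> E - N" "\<phi> f2 = \<psi> e" "en f2 = {u, w}" "\<not> covered N w"
      unfolding good_def by auto
    then have "f2 = f" using same by auto
    then have "w = u' \<or> w = u" using f f2 by auto
    then show False using f2 u' e N(1) unfolding covered_def by auto
  qed
  have "p \<in> good N' \<phi>'" if "p \<in> good N \<phi>" for p
  proof -
    obtain e2 w f2 w' where p: "p = (e2, w)" "e2 \<in> M" "w \<in> en e2" 
      "f2 \<in> E - N" "\<phi> f2 = \<psi> e2" "en f2 = {w, w'}" "\<not> covered N w'"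
      using \<open>p \<in> good N \<phi>\<close> unfolding good_def by auto
    have xw: "x \<noteq> w" using disj[OF p(2,3)] x by auto
    have xw': "x \<noteq> w'" using p(7) h(1) x unfolding covered_def by auto
    \<comment> \<open>Otherwise \<open>w\<close>, \<open>t\<close>, \<open>x\<close>,
      \<open>u'\<close>, \<open>u\<close> is a walk of length 4, so \<open>w\<close> and
      \<open>u\<close> are ends of the same edge \<open>e\<close>. They differ because
      \<open>(e, u)\<close> was not good, and \<open>e\<close> closes the walk to a 5-cycle.\<close>
    have "w' \<noteq> t"
    proof
      assume w't: "w' = t"
      have "walk (Suc (Suc (Suc (Suc 0)))) w u"
        using p(4,6) k(1,2) hE x(1) f(1,3) w't
        by (intro walk_step[of f2 w t] walk_step[of k t x] walk_step[of h x u'] 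
          walk_step[of f u' u] walk_refl) auto
      then have "e2 = e" using apart[OF p(2) e(1) p(3) e(2)] by auto
      have "w \<noteq> u" using old \<open>p \<in> good N \<phi>\<close> p(1) \<open>e2 = e\<close> by auto
      then have ew: "en e = {w, u}" using far_props[of e u] e ME ends2 p(3) \<open>e2 = e\<close> by auto
      have "en f2 = {t, w}" using p(6) w't by auto
      moreover have "{en f, en h, en k, en f2, en e} \<subseteq> en ` E"
        using f(1) hE k(1) p(4) e(1) ME by auto
      ultimately have "{{u, u'}, {u', x}, {x, t}, {t, w}, {w, u}} \<subseteq> en ` E"
        unfolding ew f(3) x(1) k(2) by simp
      moreover have "distinct [u, u', x, t, w]"
        using e u' x disj[OF e] tM[OF e] tu' \<open>t \<noteq> x\<close> \<open>w \<noteq> u\<close> xw p(3) \<open>e2 = e\<close> tM[OF p(2,3)] by auto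
      ultimately show False using no_5_cycle[of u u' x t w] by blast
    qed
    then have "\<not> covered N' w'" using cov' p(7) by auto
    then show ?thesis using p keep[OF p(4)] xw xw' unfolding good_def by auto
  qed
  then have "good N \<phi> \<subset> good N' \<phi>'" using new old by auto
  then show thesis using that st card' by blast
qed

text \<open>First the size of \<open>N\<close> is minimised, then the number of good ends is
  maximised, which is bounded by the size of \<open>Sigma M en\<close>. The condition
  \<open>u' \<notin> en e\<close> excludes edges parallel to \<open>e\<close>, whose ends are
  covered by \<open>e\<close> itself.\<close>

lemma optimal_state:
  obtains N \<phi> where "state N \<phi>"
    "\<And>e u f u'. e \<in> M \<Longrightarrow> u \<in> en e \<Longrightarrow> f \<in> E - N \<Longrightarrow> \<phi> f = \<psi> e \<Longrightarrow> en f = {u, u'} \<Longrightarrow>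
       u' \<notin> en e \<Longrightarrow> \<not> covered N u'"
proof -
  obtain N0 \<phi>0 where 0: "state N0 \<phi>0" by (rule state_exists)
  define P where "P = (\<lambda>N. \<exists>\<phi>. state N \<phi>)"
  have "P N0" using 0 unfolding P_def by auto
  then obtain N1 where N1: "P N1" "\<And>N. P N \<Longrightarrow> card N1 \<le> card N"
    using ex_has_least_nat[of P N0 card] by auto
  define Q where "Q = (\<lambda>(N, \<phi>). state N \<phi> \<and> card N = card N1)"
  obtain \<phi>1 where "Q (N1, \<phi>1)" using N1(1) unfolding P_def Q_def by auto
  define B where "B = Sigma M en"
  have "finite M" using finite_subset[OF ME finE] .
  moreover have "finite (en e)" if "e \<in> M" for e
    using that ends2 ME by (intro card_ge_0_finite) auto
  ultimately have finB: "finite B" unfolding B_def by auto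
  have goodB: "good N \<phi> \<subseteq> B" for N \<phi> unfolding good_def B_def by auto
  define m where "m = (\<lambda>(N, \<phi>). card (good N \<phi>))"
  have "m s < Suc (card B)" for s
    unfolding m_def using card_mono[OF finB goodB] by (auto split: prod.split simp: less_Suc_eq_le)
  then obtain s where s: "Q s" "\<And>s'. Q s' \<Longrightarrow> m s' \<le> m s"
    using ex_has_greatest_nat[of Q "(N1, \<phi>1)" m "Suc (card B)"] \<open>Q (N1, \<phi>1)\<close> by auto
  obtain N \<phi> where N\<phi>: "s = (N, \<phi>)" by force
  have st: "state N \<phi>" "card N = card N1" using s(1) N\<phi> unfolding Q_def by auto
  have min: "\<forall>N' \<phi>'. state N' \<phi>' \<longrightarrow> card N \<le> card N'"
    using N1(2) st(2) unfolding P_def by auto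
  show thesis
  proof (rule that[OF st(1)])
    fix e u f u'
    assume *: "e \<in> M" "u \<in> en e" "f \<in> E - N" "\<phi> f = \<psi> e" "en f = {u, u'}" "u' \<notin> en e"
    show "\<not> covered N u'"
    proof
      assume "covered N u'"
      then obtain N' \<phi>' where N': "state N' \<phi>'" "card N' = card N" "good N \<phi> \<subset> good N' \<phi>'"
        using good_increase[OF st(1) min *(1-5) _ *(6)] by blast
      then have "Q (N', \<phi>')" using st unfolding Q_def by auto
      then have "card (good N' \<phi>') \<le> card (good N \<phi>)" using s(2) N\<phi> unfolding m_def by auto
      moreover have "card (good N \<phi>) < card (good N' \<phi>')"
        using N'(3) by (intro psubset_card_mono finite_subset[OF goodB finB])
      ultimately show False by simp
    qed
  qed
qed

section \<open>Local repair at the precoloured edges\<close>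

lemma extension:
  obtains \<chi> where "edge_palette.proper en (insert z C) E \<chi>" "\<And>e. e \<in> M \<Longrightarrow> \<chi> e = \<psi> e"
proof -
  interpret big: edge_palette en "insert z C" .
  obtain N \<phi> where st: "state N \<phi>" and opt:
    "\<And>e u f u'. e \<in> M \<Longrightarrow> u \<in> en e \<Longrightarrow> f \<in> E - N \<Longrightarrow> \<phi> f = \<psi> e \<Longrightarrow> en f = {u, u'} \<Longrightarrow>
       u' \<notin> en e \<Longrightarrow> \<not> covered N u'"
    by (rule optimal_state) blast
  have N: "M \<subseteq> N" "N \<subseteq> E" "matching N" "proper (E - N) \<phi>" using st unfolding state_def by auto
  \<comment> \<open>A hit edge must give up its colour to an adjacent precoloured edge; it receives
    \<open>z\<close> instead.\<close>
  define hit where "hit f e \<longleftrightarrow> e \<in> M \<and> f \<in> E - N \<and> en e \<inter> en f \<noteq> {} \<and> \<phi> f = \<psi> e" for f e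
  define \<chi> where "\<chi> f = (if f \<in> M then \<psi> f else if f \<in> N \<or> (\<exists>e. hit f e) then z else \<phi> f)" for f
  have \<phi>C: "\<phi> f \<in> C" if "f \<in> E - N" for f using N(4) that unfolding proper_def by auto
  have link: "walk (Suc 0) u v" if "f \<in> E" "u \<in> en f" "v \<in> en f" "u \<noteq> v" for f u v
  proof -
    have "en f = {u, v}" using far_props[of f u] ends2 that by auto
    then show ?thesis using that by (intro walk_step[of f]) (auto intro: walk_refl)
  qed
  have link': "\<exists>n\<le>1. walk n u v" if "f \<in> E" "u \<in> en f" "v \<in> en f" for f u v
    using link[OF that] walk_refl[of u] by (cases "u = v") auto
  have near1: "e = e'" if "e \<in> M" "e' \<in> M" "f \<in> E" "en e \<inter> en f \<noteq> {}" "en e' \<inter> en f \<noteq> {}" for e e' f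
    using that link'[OF that(3)] apart[OF that(1,2)] by (metis disjoint_iff le_trans one_le_numeral)
  have near2: "e = e'" if ef: "e \<in> M" "e' \<in> M" "f \<in> E" "f' \<in> E" "en e \<inter> en f \<noteq> {}" "en e' \<inter> en f' \<noteq> {}"
    "v \<in> en f" "v \<in> en f'" for e e' f f' v
  proof -
    obtain u u' where u: "u \<in> en e" "u \<in> en f" "u' \<in> en e'" "u' \<in> en f'" using ef by auto
    show ?thesis
    proof (cases "u = v")
      case True
      then show ?thesis using near1[OF ef(1,2,4)] u ef by blast
    next
      case False
      then have f: "en f = {u, v}" using far_props[of f u] ends2 u ef by auto
      obtain n where n: "n \<le> 1" "walk n v u'" using link'[OF ef(4,8) u(4)] by auto
      have "walk (Suc n) u u'" using walk_step[OF ef(3) f n(2)] .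
      then show ?thesis using apart[OF ef(1,2) u(1,3)] n(1) by auto
    qed
  qed
  have MM: "\<chi> e \<noteq> \<chi> f" if "e \<in> M" "f \<in> E" "e \<noteq> f" "v \<in> en e" "v \<in> en f" for e f v
  proof -
    have "f \<notin> N" using matchingD[OF N(3) _ _ that(4,5)] that N(1) by auto
    then have fE: "f \<in> E - N" "f \<notin> M" using that N by auto
    show ?thesis
    proof (cases "\<exists>e'. hit f e'")
      case True
      then obtain e' where e': "hit f e'" by auto
      then have "e' = e" using near1[of e' e f] that unfolding hit_def by auto
      \<comment> \<open>A hit edge has its old colour in \<open>C\<close>, so the edge of
        \<open>M\<close> that hits it really gives up \<open>z\<close>.\<close>
      then have "\<psi> e \<noteq> z" using e' \<phi>C[OF fE(1)] z_new unfolding hit_def by auto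
      then show ?thesis using True fE that(1) unfolding \<chi>_def by auto
    next
      case False
      then have "\<phi> f \<noteq> \<psi> e" using fE that unfolding hit_def by auto
      then show ?thesis using False fE \<open>f \<notin> N\<close> that(1) unfolding \<chi>_def by auto
    qed
  qed
  \<comment> \<open>The end of \<open>f\<close> on \<open>e\<close> is covered by \<open>e\<close>
    only, and any end off \<open>e\<close> is uncovered by optimality; so \<open>z\<close> on
    \<open>f\<close> clashes with no other edge of \<open>N\<close>.\<close>
  have hit_free: "\<not> covered (N - {e}) v" if fe: "hit f e" "v \<in> en f" for f e v
  proof
    assume "covered (N - {e}) v"
    then obtain h where h: "h \<in> N" "h \<noteq> e" "v \<in> en h" unfolding covered_def by auto
    have f: "e \<in> M" "f \<in> E - N" "\<phi> f = \<psi> e" using fe unfolding hit_def by auto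
    obtain u where u: "u \<in> en e" "u \<in> en f" using fe unfolding hit_def by auto
    have ve: "v \<notin> en e" using matchingD[OF N(3) h(1) _ h(3), of e] h f(1) N(1) by auto
    then have "en f = {u, v}" using far_props[of f u] ends2 f u fe(2) by auto
    then have "\<not> covered N v" using opt[OF f(1) u(1) f(2,3)] ve by auto
    then show False using h unfolding covered_def by auto
  qed
  have "big.proper E \<chi>"
  proof (rule big.properI)
    fix e assume "e \<in> E"
    then show "\<chi> e \<in> insert z C" using \<psi>_in \<phi>C unfolding \<chi>_def by auto
  next
    fix e f v assume *: "e \<in> E" "f \<in> E" "v \<in> en e" "v \<in> en f" "\<chi> e = \<chi> f"
    have Nf: False if ef: "e \<in> N" "e \<notin> M" "f \<in> E - N" "v \<in> en e" "v \<in> en f" "\<chi> e = \<chi> f" for e f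
    proof -
      have "\<chi> f = z" "f \<notin> M" using ef N(1) unfolding \<chi>_def by auto
      then obtain e' where e': "hit f e'" using ef \<phi>C[of f] z_new unfolding \<chi>_def
        by (auto split: if_splits)
      moreover have "e \<noteq> e'" using e' ef unfolding hit_def by auto
      ultimately show False using hit_free[OF e' ef(5)] ef unfolding covered_def by auto
    qed
    show "e = f"
    proof (rule ccontr)
      assume "e \<noteq> f"
      then have M: "e \<notin> M" "f \<notin> M" using MM[of e f v] MM[of f e v] * by auto
      have nN: "e \<notin> N" "f \<notin> N"
        using Nf[of e f] Nf[of f e] M * matchingD[OF N(3) _ _ *(3,4)] \<open>e \<noteq> f\<close> by auto
      have "\<phi> e \<noteq> \<phi> f" using properD[OF N(4), of e f v] nN * \<open>e \<noteq> f\<close> by auto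
      moreover have "\<phi> e \<noteq> z" "\<phi> f \<noteq> z" using \<phi>C nN * z_new by auto
      ultimately obtain a b where ab: "hit e a" "hit f b"
        using *(5) M nN unfolding \<chi>_def by (auto split: if_splits)
      \<comment> \<open>Adjacent hit edges are hit by the same edge of \<open>M\<close>, hence had
        equal colours before, against properness.\<close>
      then have "a = b" using near2[of a b e f v] * unfolding hit_def by auto
      then show False using ab \<open>\<phi> e \<noteq> \<phi> f\<close> unfolding hit_def by auto
    qed
  qed
  moreover have "\<chi> e = \<psi> e" if "e \<in> M" for e using that unfolding \<chi>_def by auto
  ultimately show thesis using that by blast
qed

end

section \<open>Transfer to the multigraph notions of the theorem\<close>

text \<open>By induction a path from the second vertex is at hand; if it already visits
  \<open>u\<close>, its part before \<open>u\<close> is cut off, otherwise \<open>u\<close> is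
  prepended.\<close>

lemma walk_imp_path:
  assumes "wf_multigraph G" "bounded_multigraph (ends G) C (edges G) \<Delta> \<mu>"
    and "bounded_multigraph.walk (ends G) (edges G) n u v" "u \<in> verts G"
  shows "\<exists>vs es. is_path G vs es \<and> hd vs = u \<and> last vs = v \<and> length es \<le> n"
proof -
  interpret bounded_multigraph "ends G" C "edges G" \<Delta> \<mu> by fact
  show ?thesis using assms(3,4)
  proof induction
    case (walk_refl u)
    then show ?case by (intro exI[of _ "[u]"] exI[of _ "[]"]) (auto simp: is_path_def)
  next
    case (walk_step k u w n v)
    have "w \<in> verts G" using walk_step assms(1) unfolding wf_multigraph_def by auto
    then obtain vs es where p: "is_path G vs es" "hd vs = w" "last vs = v" "length es \<le> n"
      using walk_step.IH by auto
    show ?case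
    proof (cases "u \<in> set vs")
      case True
      then obtain i where i: "i < length vs" "vs ! i = u" by (auto simp: in_set_conv_nth)
      have "is_path G (drop i vs) (drop i es)"
        using p(1) i(1) set_drop_subset[of i vs] set_drop_subset[of i es] unfolding is_path_def by auto
      moreover have "hd (drop i vs) = u" using i by (simp add: hd_drop_conv_nth)
      moreover have "last (drop i vs) = v" using i p(3) by simp
      ultimately show ?thesis using p(4) by (intro exI[of _ "drop i vs"] exI[of _ "drop i es"]) auto
    next
      case False
      have "vs \<noteq> []" using p(1) unfolding is_path_def by auto
      then have "vs ! 0 = w" using p(2) by (simp add: hd_conv_nth)
      have "is_path G (u # vs) (k # es)"
        using p(1) False walk_step.hyps walk_step.prems \<open>vs ! 0 = w\<close>
        unfolding is_path_def by (auto simp: nth_Cons split: nat.split)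
      then show ?thesis using p(3,4) \<open>vs \<noteq> []\<close> by (intro exI[of _ "u # vs"] exI[of _ "k # es"]) auto
    qed
  qed
qed

lemma degree_le_max:
  assumes "wf_multigraph G"
  shows "card {e \<in> edges G. v \<in> ends G e} \<le> max_degree G"
proof (cases "v \<in> verts G")
  case True
  have "degree G v \<le> max_degree G"
    using assms True unfolding max_degree_def wf_multigraph_def by (intro Max_ge) auto
  then show ?thesis unfolding degree_def .
next
  case False
  then have "{e \<in> edges G. v \<in> ends G e} = {}" using assms unfolding wf_multigraph_def by auto
  then show ?thesis by (simp only: card.empty)
qed

lemma multiplicity_le_max:
  assumes "wf_multigraph G"
  shows "card {e \<in> edges G. ends G e = {u, v}} \<le> max_multiplicity G"
proof (cases "u \<in> verts G \<and> v \<in> verts G")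
  case True
  have "{multiplicity G u v |u v. u \<in> verts G \<and> v \<in> verts G} =
      (\<lambda>(u, v). multiplicity G u v) ` (verts G \<times> verts G)" by auto
  then have "finite {multiplicity G u v |u v. u \<in> verts G \<and> v \<in> verts G}"
    using assms unfolding wf_multigraph_def by simp
  then have "multiplicity G u v \<le> max_multiplicity G"
    using True unfolding max_multiplicity_def by (intro Max_ge) auto
  then show ?thesis unfolding multiplicity_def .
next
  case False
  then have "{e \<in> edges G. ends G e = {u, v}} = {}" using assms unfolding wf_multigraph_def by auto
  then show ?thesis by (simp only: card.empty)
qed

text \<open>The chosen edges are distinct because their end sets are.\<close>

lemma has_5_cycle:
  assumes "wf_multigraph G" "distinct [a, b, c, d, v]"
    and "{{a, b}, {b, c}, {c, d}, {d, v}, {v, a}} \<subseteq> ends G ` edges G"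
  shows "has_cycle_of_length G 5"
proof -
  obtain e1 e2 e3 e4 e5 where e: "set [e1, e2, e3, e4, e5] \<subseteq> edges G"
    "ends G e1 = {a, b}" "ends G e2 = {b, c}" "ends G e3 = {c, d}" "ends G e4 = {d, v}" "ends G e5 = {v, a}"
    using assms(3) by (auto simp: image_iff)
  have "set [a, b, c, d, v] \<subseteq> verts G" using e assms(1) unfolding wf_multigraph_def by auto
  moreover have "distinct [e1, e2, e3, e4, e5]"
    using e(2-6) assms(2) by (auto simp: doubleton_eq_iff)
  moreover have "ends G ([e1, e2, e3, e4, e5] ! i) = {[a, b, c, d, v] ! i, [a, b, c, d, v] ! (Suc i mod 5)}"
    if "i < 5" for i
  proof -
    have "i = 0 \<or> i = 1 \<or> i = 2 \<or> i = 3 \<or> i = 4" using that by auto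
    then show ?thesis using e by auto
  qed
  ultimately have "is_cycle G [a, b, c, d, v] [e1, e2, e3, e4, e5]"
    using e(1) assms(2) unfolding is_cycle_def by simp
  then show ?thesis unfolding has_cycle_of_length_def by force
qed

theorem theorem4:
  fixes G :: "('v, 'e) multigraph" and M :: "'e set" and \<Delta> \<mu> :: nat
    and \<K> :: "nat set" and \<psi> :: "'e \<Rightarrow> nat"
  assumes "wf_multigraph G"
    and "\<mu> = max_multiplicity G"
    and "\<Delta> = max_degree G"
    and "\<not> has_cycle_of_length G 5"
    and "M \<subseteq> edges G"
    and "\<And>e f. e \<in> M \<Longrightarrow> f \<in> M \<Longrightarrow> e \<noteq> f \<Longrightarrow> edge_dist G e f \<ge> 5"
    and "\<K> = {1..\<Delta> + \<mu>}"
    and "\<And>e. e \<in> M \<Longrightarrow> \<psi> e \<in> \<K>"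
  shows "\<exists>\<phi>. proper_edge_colouring G \<K> \<phi> \<and> (\<forall>e\<in>M. \<phi> e = \<psi> e)"
proof (cases "edges G = {}")
  case True
  then show ?thesis using assms(5) unfolding proper_edge_colouring_def by auto
next
  case False
  \<comment> \<open>The colour 1 plays the part of \<open>z\<close>.\<close>
  define C where "C = {2..\<Delta> + \<mu>}"
  obtain e0 where e0: "e0 \<in> edges G" using False by auto
  then obtain v0 where v0: "v0 \<in> ends G e0"
    using assms(1) unfolding wf_multigraph_def by fastforce
  \<comment> \<open>An existing edge makes \<Delta> positive, so that 1 belongs to the
    palette.\<close>
  have "{e \<in> edges G. v0 \<in> ends G e} \<noteq> {}" using e0 v0 by auto
  then have "0 < card {e \<in> edges G. v0 \<in> ends G e}"
    using assms(1) unfolding wf_multigraph_def by (simp add: card_gt_0_iff)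
  then have "0 < \<Delta>" using degree_le_max[OF assms(1), of v0] assms(3) by linarith
  then have K: "\<K> = insert 1 C" unfolding assms(7) C_def by auto
  have bounded: "bounded_multigraph (ends G) C (edges G) \<Delta> \<mu>"
    using assms(1) degree_le_max[OF assms(1)] multiplicity_le_max[OF assms(1)]
    unfolding bounded_multigraph_def assms(2,3) wf_multigraph_def C_def by auto
  interpret bounded_multigraph "ends G" C "edges G" \<Delta> \<mu> by fact
  interpret sparse_precolouring "ends G" C "edges G" \<Delta> \<mu> M \<psi> 1
  proof
    show "M \<subseteq> edges G" "1 \<notin> C" using assms(5) unfolding C_def by auto
    show "\<psi> e \<in> insert 1 C" if "e \<in> M" for e using assms(8) that K by auto
    show "e = f" if ef: "e \<in> M" "f \<in> M" "u \<in> ends G e" "v \<in> ends G f" "walk n u v" "n \<le> 4" for e f u v n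
    proof (rule ccontr)
      assume "e \<noteq> f"
      have "u \<in> verts G" using ef assms(1,5) unfolding wf_multigraph_def by auto
      then obtain vs es where p: "is_path G vs es" "hd vs = u" "last vs = v" "length es \<le> n"
        using walk_imp_path[OF assms(1) bounded ef(5)] by blast
      have "edge_dist G e f \<le> enat (length es)"
        unfolding edge_dist_def using p ef by (intro Inf_lower) auto
      also have "\<dots> \<le> enat 4" using p(4) ef(6) by simp
      finally have "(5 :: enat) \<le> enat 4" using assms(6)[OF ef(1,2) \<open>e \<noteq> f\<close>] by (rule order_trans[rotated])
      then show False by (simp add: numeral_eq_enat)
    qed
    show False if "distinct [a, b, c, d, v]"
      "{{a, b}, {b, c}, {c, d}, {d, v}, {v, a}} \<subseteq> ends G ` edges G" for a b c d v
      using has_5_cycle[OF assms(1) that] assms(4) by blast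
  qed
  obtain \<chi> where \<chi>: "edge_palette.proper (ends G) (insert 1 C) (edges G) \<chi>" "\<And>e. e \<in> M \<Longrightarrow> \<chi> e = \<psi> e"
    by (rule extension) blast
  have "proper_edge_colouring G \<K> \<chi>"
    using \<chi>(1) unfolding edge_palette.proper_def proper_edge_colouring_def K .
  then show ?thesis using \<chi>(2) by auto
qed

end
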